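(* Let $G$ be a group and let $X$ be a $G$-subshift of finite type. Then $X$ is homotopy equivalent to a one-point subshift if and only if $X$ is contractible and contains a fixed point (a point fixed by all of $G$).
   Context: For a finite set $A$ (alphabet) and a group $G$, $A^G$ carries the product topology (discrete $A$) and the shift action $(gx)_h = x_{g^{-1}h}$. A subshift is a topologically closed, shift-invariant subset $X \subset A^G$. A finite pattern is an element $p \in A^D$ with $D \subset G$ finite; it appears in $x \in A^G$ if for some $g \in G$ one has $x_{gd} = p_d$ for all $d \in D$. $X$ is of finite type (SFT) if there is a finite set of finite patterns such that $X$ is the set of all $x \in A^G$ in which none of them appears. A block map (morphism) between $G$-subshifts is a continuous shift-commuting map; products carry the diagonal action. Let $I = \{0,1\}^G$, with constant configurations $\bar 0, \bar 1$. Two block maps $f, g : X \to Y$ are homotopic, $f \cong g$, if there is a block map $h : I \times X \to Y$ with $h(\bar 0, x) = f(x)$ and $h(\bar 1, x) = g(x)$ for all $x \in X$. Two subshifts $X, Y$ are homotopy equivalent if there are block maps $f : X \to Y$ and $g : Y \to X$ such that $g \circ f \cong \mathrm{id}_X$ and $f \circ g \cong \mathrm{id}_Y$. A subshift $X$ is contractible if the two projections $\pi_1, \pi_2 : X \times X \to X$ are homotopic, i.e. there is a block map $h : I \times X \times X \to X$ with $h(\bar 0, x, y) = x$ and $h(\bar 1, x, y) = y$ for all $x, y \in X$. *)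

theory Defs
  imports
    "HOL-Analysis.Product_Topology"
    "HOL-Analysis.Function_Topology"
    "HOL-Algebra.Group"
begin

text \<open>
  A configuration in \<open>A\<^sup>G\<close> is a function that takes values in \<open>A\<close> on \<open>carrier G\<close> and is
  \<open>undefined\<close> elsewhere, so that the points of the product topology below are exactly
  the elements of \<open>carrier G \<rightarrow>\<^sub>E A\<close>.
\<close>

definition config_topology :: "('g, 'm) monoid_scheme \<Rightarrow> 'a set \<Rightarrow> ('g \<Rightarrow> 'a) topology" where
  "config_topology G A = product_topology (\<lambda>_. discrete_topology A) (carrier G)"

definition shift_act :: "('g, 'm) monoid_scheme \<Rightarrow> 'g \<Rightarrow> ('g \<Rightarrow> 'a) \<Rightarrow> ('g \<Rightarrow> 'a)" where
  "shift_act G g x = (\<lambda>h\<in>carrier G. x (inv\<^bsub>G\<^esub> g \<otimes>\<^bsub>G\<^esub> h))"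

definition subshift :: "('g, 'm) monoid_scheme \<Rightarrow> 'a set \<Rightarrow> ('g \<Rightarrow> 'a) set \<Rightarrow> bool" where
  "subshift G A X \<longleftrightarrow>
     finite A \<and> closedin (config_topology G A) X \<and>
     (\<forall>g\<in>carrier G. \<forall>x\<in>X. shift_act G g x \<in> X)"

text \<open>A finite pattern \<open>p \<in> A\<^sup>D\<close> is represented by the pair \<open>(D, p)\<close>.\<close>

definition finite_pattern ::
    "('g, 'm) monoid_scheme \<Rightarrow> 'a set \<Rightarrow> 'g set \<times> ('g \<Rightarrow> 'a) \<Rightarrow> bool" where
  "finite_pattern G A P \<longleftrightarrow>
     (case P of (D, p) \<Rightarrow> finite D \<and> D \<subseteq> carrier G \<and> p \<in> D \<rightarrow>\<^sub>E A)"

definition appears_in ::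
    "('g, 'm) monoid_scheme \<Rightarrow> 'g set \<times> ('g \<Rightarrow> 'a) \<Rightarrow> ('g \<Rightarrow> 'a) \<Rightarrow> bool" where
  "appears_in G P x \<longleftrightarrow>
     (case P of (D, p) \<Rightarrow> \<exists>g\<in>carrier G. \<forall>d\<in>D. x (g \<otimes>\<^bsub>G\<^esub> d) = p d)"

definition subshift_of_finite_type ::
    "('g, 'm) monoid_scheme \<Rightarrow> 'a set \<Rightarrow> ('g \<Rightarrow> 'a) set \<Rightarrow> bool" where
  "subshift_of_finite_type G A X \<longleftrightarrow>
     subshift G A X \<and>
     (\<exists>F. finite F \<and> (\<forall>P\<in>F. finite_pattern G A P) \<and>
          X = {x \<in> carrier G \<rightarrow>\<^sub>E A. \<forall>P\<in>F. \<not> appears_in G P x})"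

text \<open>
  Products of subshifts are taken as product spaces with the diagonal action, rather than
  being recoded as subshifts over a product alphabet. Block maps are therefore defined between
  spaces equipped with an action; a map only matters on the points of its source.
\<close>

record ('g, 'x) gspace =
  gtop :: "'x topology"
  gact :: "'g \<Rightarrow> 'x \<Rightarrow> 'x"

definition subshift_space ::
    "('g, 'm) monoid_scheme \<Rightarrow> 'a set \<Rightarrow> ('g \<Rightarrow> 'a) set \<Rightarrow> ('g, 'g \<Rightarrow> 'a) gspace" where
  "subshift_space G A X =
     \<lparr>gtop = subtopology (config_topology G A) X, gact = shift_act G\<rparr>"

definition prod_space ::
    "('g, 'x) gspace \<Rightarrow> ('g, 'y) gspace \<Rightarrow> ('g, 'x \<times> 'y) gspace" where
  "prod_space S T =
     \<lparr>gtop = prod_topology (gtop S) (gtop T),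
      gact = (\<lambda>g (x, y). (gact S g x, gact T g y))\<rparr>"

definition block_map ::
    "('g, 'm) monoid_scheme \<Rightarrow> ('g, 'x) gspace \<Rightarrow> ('g, 'y) gspace \<Rightarrow> ('x \<Rightarrow> 'y) \<Rightarrow> bool" where
  "block_map G S T f \<longleftrightarrow>
     continuous_map (gtop S) (gtop T) f \<and>
     (\<forall>g\<in>carrier G. \<forall>x\<in>topspace (gtop S). f (gact S g x) = gact T g (f x))"

definition interval_space :: "('g, 'm) monoid_scheme \<Rightarrow> ('g, 'g \<Rightarrow> nat) gspace" where
  "interval_space G = subshift_space G {0, 1} (carrier G \<rightarrow>\<^sub>E {0, 1})"

definition const_config :: "('g, 'm) monoid_scheme \<Rightarrow> 'a \<Rightarrow> ('g \<Rightarrow> 'a)" where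
  "const_config G a = (\<lambda>h\<in>carrier G. a)"

definition block_homotopic ::
    "('g, 'm) monoid_scheme \<Rightarrow> ('g, 'x) gspace \<Rightarrow> ('g, 'y) gspace \<Rightarrow>
     ('x \<Rightarrow> 'y) \<Rightarrow> ('x \<Rightarrow> 'y) \<Rightarrow> bool" where
  "block_homotopic G S T f g \<longleftrightarrow>
     block_map G S T f \<and> block_map G S T g \<and>
     (\<exists>h. block_map G (prod_space (interval_space G) S) T h \<and>
          (\<forall>x\<in>topspace (gtop S).
             h (const_config G 0, x) = f x \<and> h (const_config G 1, x) = g x))"

definition block_homotopy_equivalent ::
    "('g, 'm) monoid_scheme \<Rightarrow> ('g, 'x) gspace \<Rightarrow> ('g, 'y) gspace \<Rightarrow> bool" where
  "block_homotopy_equivalent G S T \<longleftrightarrow>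
     (\<exists>f g. block_map G S T f \<and> block_map G T S g \<and>
            block_homotopic G S S (g \<circ> f) id \<and> block_homotopic G T T (f \<circ> g) id)"

definition block_contractible ::
    "('g, 'm) monoid_scheme \<Rightarrow> ('g, 'x) gspace \<Rightarrow> bool" where
  "block_contractible G S \<longleftrightarrow> block_homotopic G (prod_space S S) S fst snd"

end

theory Submission
  imports Defs "HOL-Analysis.Abstract_Topological_Spaces"
begin

text \<open>
  Only the implication from homotopy equivalence to contractibility is not formal. Let \<open>H\<close> contract
  \<open>X\<close> to the fixed point \<open>z\<close>, with \<open>H (0, x) = z\<close> and \<open>H (1, x) = x\<close>. By compactness there is a
  finite \<open>M\<close> such that \<open>H (i, x)\<close> agrees with \<open>z\<close> at \<open>g\<close> whenever \<open>i\<close> vanishes on \<open>gM\<close>. For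
  \<open>v = 0, 1\<close> let \<open>i\<^sub>v\<close> be the indicator of the set of \<open>g\<close> with \<open>i = v\<close> on \<open>gN\<close>, for a large finite
  set \<open>N\<close>. The configuration equal to \<open>H (i\<^sub>0, x)\<close> where \<open>i\<close> is 0 and to \<open>H (i\<^sub>1, y)\<close> where \<open>i\<close> is 1
  is \<open>x\<close> for \<open>i = 0\<close> and \<open>y\<close> for \<open>i = 1\<close>. It lies in \<open>X\<close>: in a window of a forbidden pattern on which
  \<open>i\<close> is constant it agrees with \<open>H (i\<^sub>0, x)\<close> or with \<open>H (i\<^sub>1, y)\<close>, and in any other window it agrees
  with \<open>z\<close>, because both \<open>i\<^sub>0\<close> and \<open>i\<^sub>1\<close> vanish near that window.
\<close>

section \<open>Configuration spaces and continuity into subshifts\<close>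

lemma topspace_config_topology [simp]:
  "topspace (config_topology G A) = carrier G \<rightarrow>\<^sub>E A"
  by (simp add: config_topology_def)

lemma subshift_subset: "subshift G A X \<Longrightarrow> X \<subseteq> carrier G \<rightarrow>\<^sub>E A"
  using closedin_subset by (fastforce simp: subshift_def)

lemma gact_subshift_space [simp]: "gact (subshift_space G A X) = shift_act G"
  by (simp add: subshift_space_def)

lemma topspace_subshift_space:
  "X \<subseteq> carrier G \<rightarrow>\<^sub>E A \<Longrightarrow> topspace (gtop (subshift_space G A X)) = X"
  by (auto simp: subshift_space_def)

lemma gtop_prod_space [simp]: "gtop (prod_space S T) = prod_topology (gtop S) (gtop T)"
  by (simp add: prod_space_def)

lemma gact_prod_space [simp]: "gact (prod_space S T) g (x, y) = (gact S g x, gact T g y)"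
  by (simp add: prod_space_def)

lemma topspace_interval_space [simp]:
  "topspace (gtop (interval_space G)) = carrier G \<rightarrow>\<^sub>E {0, 1}"
  by (simp add: interval_space_def topspace_subshift_space)

lemma gact_interval_space [simp]: "gact (interval_space G) = shift_act G"
  by (simp add: interval_space_def)

lemma const_config_in_PiE [simp]: "a \<in> A \<Longrightarrow> const_config G a \<in> carrier G \<rightarrow>\<^sub>E A"
  by (simp add: const_config_def)

lemma shift_act_apply: "h \<in> carrier G \<Longrightarrow> shift_act G g x h = x (inv\<^bsub>G\<^esub> g \<otimes>\<^bsub>G\<^esub> h)"
  by (simp add: shift_act_def)

lemma (in group) shift_act_const_config:
  "g \<in> carrier G \<Longrightarrow> shift_act G g (const_config G a) = const_config G a"
  by (auto simp: shift_act_def const_config_def)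

text \<open>The topology is a product of discrete ones, so continuity is tested symbol by symbol.
  The extensionality in the componentwise criterion is automatic for maps into
  \<open>X\<close>.\<close>

lemma continuous_map_subshift_space:
  assumes "X \<subseteq> carrier G \<rightarrow>\<^sub>E A"
  shows "continuous_map T (gtop (subshift_space G A X)) f \<longleftrightarrow>
    f \<in> topspace T \<rightarrow> X \<and> (\<forall>g\<in>carrier G. continuous_map T (discrete_topology A) (\<lambda>t. f t g))"
proof -
  have "f ` topspace T \<subseteq> extensional (carrier G)" if "f \<in> topspace T \<rightarrow> X"
    using that assms by (fastforce simp: PiE_def)
  then show ?thesis
    by (auto simp: subshift_space_def config_topology_def continuous_map_in_subtopology
        continuous_map_componentwise)
qed

section \<open>Closure properties of block maps\<close>

lemma block_map_range:
  "block_map G S T f \<Longrightarrow> x \<in> topspace (gtop S) \<Longrightarrow> f x \<in> topspace (gtop T)"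
  by (auto simp: block_map_def continuous_map_def)

lemma block_map_equivariant:
  "block_map G S T f \<Longrightarrow> g \<in> carrier G \<Longrightarrow> x \<in> topspace (gtop S) \<Longrightarrow> f (gact S g x) = gact T g (f x)"
  by (simp add: block_map_def)

lemma block_map_id: "block_map G S S id"
  by (simp add: block_map_def)

lemma block_map_compose:
  "block_map G S T f \<Longrightarrow> block_map G T U f' \<Longrightarrow> block_map G S U (f' \<circ> f)"
  using block_map_range[of G S T f]
  by (auto simp: block_map_def intro: continuous_map_compose)

lemma block_map_fst: "block_map G (prod_space S T) S fst"
  by (auto simp: block_map_def continuous_map_fst)

lemma block_map_snd: "block_map G (prod_space S T) T snd"
  by (auto simp: block_map_def continuous_map_snd)

lemma block_map_pair:
  "block_map G R S f \<Longrightarrow> block_map G R T f' \<Longrightarrow> block_map G R (prod_space S T) (\<lambda>r. (f r, f' r))"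
  by (auto simp: block_map_def continuous_map_pairedI)

lemma block_map_const:
  assumes "z \<in> topspace (gtop T)" and "\<And>g. g \<in> carrier G \<Longrightarrow> gact T g z = z"
  shows "block_map G S T (\<lambda>_. z)"
  using assms by (auto simp: block_map_def)

section \<open>Local rules as block maps\<close>

lemma continuous_map_discrete_binop:
  assumes "continuous_map T (discrete_topology U) f" "continuous_map T (discrete_topology V) g"
    and "\<And>u v. u \<in> U \<Longrightarrow> v \<in> V \<Longrightarrow> F u v \<in> W"
  shows "continuous_map T (discrete_topology W) (\<lambda>t. F (f t) (g t))"
proof -
  have "continuous_map T (discrete_topology (U \<times> V)) (\<lambda>t. (f t, g t))"
    unfolding prod_topology_discrete_topology by (intro continuous_map_pairedI assms)
  moreover have "continuous_map (discrete_topology (U \<times> V)) (discrete_topology W) (\<lambda>(u, v). F u v)"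
    using assms(3) by auto
  ultimately have "continuous_map T (discrete_topology W) ((\<lambda>(u, v). F u v) \<circ> (\<lambda>t. (f t, g t)))"
    by (rule continuous_map_compose)
  then show ?thesis
    by (simp add: o_def)
qed

lemma continuous_map_discrete_Ball:
  assumes "finite N"
    and "\<And>n. n \<in> N \<Longrightarrow> continuous_map T (discrete_topology UNIV) (\<lambda>t. P n t :: bool)"
  shows "continuous_map T (discrete_topology UNIV) (\<lambda>t. \<forall>n\<in>N. P n t)"
  using assms
proof (induction N rule: finite_induct)
  case (insert n N)
  then have "continuous_map T (discrete_topology UNIV) (\<lambda>t. P n t \<and> (\<forall>n\<in>N. P n t))"
    by (intro continuous_map_discrete_binop[where F = "(\<and>)"]) auto
  then show ?case by simp
qed simp

text \<open>The symbol at \<open>g\<close> is computed from three symbols at \<open>g\<close> by a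
  rule independent of \<open>g\<close>, which gives continuity and equivariance. Gluing may leave
  \<open>X\<close>, so membership is assumed and has to be proved for each use.\<close>

lemma block_map_switch:
  assumes X: "X \<subseteq> carrier G \<rightarrow>\<^sub>E A" and G: "group G"
    and c: "block_map G T (interval_space G) c"
    and u: "block_map G T (subshift_space G A X) u"
    and v: "block_map G T (subshift_space G A X) v"
    and mem: "\<And>t. t \<in> topspace (gtop T) \<Longrightarrow>
      (\<lambda>g\<in>carrier G. if c t g = 0 then u t g else v t g) \<in> X"
  shows "block_map G T (subshift_space G A X)
    (\<lambda>t. \<lambda>g\<in>carrier G. if c t g = 0 then u t g else v t g)"
proof -
  interpret group G by (rule G)
  have "continuous_map (gtop T) (discrete_topology A) (\<lambda>t. if c t g = 0 then u t g else v t g)"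
    if g: "g \<in> carrier G" for g
  proof -
    have c': "continuous_map (gtop T) (discrete_topology {0, 1}) (\<lambda>t. c t g)"
      and u': "continuous_map (gtop T) (discrete_topology A) (\<lambda>t. u t g)"
      and v': "continuous_map (gtop T) (discrete_topology A) (\<lambda>t. v t g)"
      using c u v g X
      by (simp_all add: block_map_def interval_space_def continuous_map_subshift_space)
    have uv: "continuous_map (gtop T) (discrete_topology (A \<times> A)) (\<lambda>t. (u t g, v t g))"
      by (rule continuous_map_discrete_binop[OF u' v']) auto
    have "continuous_map (gtop T) (discrete_topology A)
        (\<lambda>t. if c t g = 0 then fst (u t g, v t g) else snd (u t g, v t g))"
      by (rule continuous_map_discrete_binop[OF c' uv,
            where F = "\<lambda>i p. if i = 0 then fst p else snd p"]) auto
    then show ?thesis by (simp cong: if_cong)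
  qed
  then show ?thesis
    using mem block_map_equivariant[OF c] block_map_equivariant[OF u] block_map_equivariant[OF v]
    by (auto simp: block_map_def continuous_map_subshift_space[OF X] shift_act_def)
qed

section \<open>Morphological erosion of the level sets of a binary configuration\<close>

definition erode :: "('g, 'm) monoid_scheme \<Rightarrow> 'g set \<Rightarrow> nat \<Rightarrow> ('g \<Rightarrow> nat) \<Rightarrow> ('g \<Rightarrow> nat)" where
  "erode G N v i = (\<lambda>g\<in>carrier G. if \<forall>n\<in>N. i (g \<otimes>\<^bsub>G\<^esub> n) = v then 1 else 0)"

text \<open>Erosion is a sliding block code with finite window \<open>N\<close>: finiteness gives
  continuity, and equivariance holds because left translation commutes with right multiplication by
  elements of \<open>N\<close>.\<close>

lemma (in group) block_map_erode:
  assumes N: "finite N" "N \<subseteq> carrier G"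
  shows "block_map G (interval_space G) (interval_space G) (erode G N v)"
proof -
  let ?I = "interval_space G"
  have coord: "continuous_map (gtop ?I) (discrete_topology {0, 1}) (\<lambda>i. i g)"
    if "g \<in> carrier G" for g
    using continuous_map_from_subtopology[OF continuous_map_product_projection[OF that]]
    by (simp add: interval_space_def subshift_space_def config_topology_def)
  have "continuous_map (gtop ?I) (discrete_topology {0, 1}) (\<lambda>i. erode G N v i g)"
    if g: "g \<in> carrier G" for g
  proof -
    have "continuous_map (gtop ?I) (discrete_topology UNIV) (\<lambda>i. i (g \<otimes> n) = v)" if "n \<in> N" for n
      using that N g
        continuous_map_compose[OF coord, of "g \<otimes> n" "discrete_topology UNIV" "\<lambda>k. k = v"]
      by (auto simp: o_def)
    then have "continuous_map (gtop ?I) (discrete_topology UNIV) (\<lambda>i. \<forall>n\<in>N. i (g \<otimes> n) = v)"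
      by (intro continuous_map_discrete_Ball N)
    from continuous_map_compose[OF this, of "discrete_topology {0, 1}" "\<lambda>b. if b then 1 else (0::nat)"]
    show ?thesis
      using g by (simp add: o_def erode_def)
  qed
  moreover have "erode G N v i \<in> carrier G \<rightarrow>\<^sub>E {0, 1}" for i
    by (auto simp: erode_def)
  moreover have "erode G N v (shift_act G g i) = shift_act G g (erode G N v i)"
    if "g \<in> carrier G" for g i
  proof
    fix h
    have "shift_act G g i (h \<otimes> n) = i (inv g \<otimes> h \<otimes> n)" if "h \<in> carrier G" "n \<in> N" for n
      using that N \<open>g \<in> carrier G\<close> by (simp add: shift_act_apply m_assoc subset_iff)
    then show "erode G N v (shift_act G g i) h = shift_act G g (erode G N v i) h"
      using that by (auto simp: erode_def shift_act_def)
  qed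
  ultimately show ?thesis
    by (auto simp: block_map_def interval_space_def continuous_map_subshift_space)
qed

lemma (in group) erode_const_config:
  "N \<subseteq> carrier G \<Longrightarrow> erode G N v (const_config G v) = const_config G 1"
  by (auto simp: erode_def const_config_def subset_iff)

text \<open>The site \<open>k\<close> lies in the window of \<open>g\<close>, so a single wrong
  symbol at \<open>k\<close> spoils the erosion at \<open>g\<close>.\<close>

lemma (in group) erode_eq_0:
  assumes "g \<in> carrier G" "k \<in> carrier G" "N \<subseteq> carrier G" "inv g \<otimes> k \<in> N" "i k \<noteq> v"
  shows "erode G N v i g = 0"
proof -
  have "g \<otimes> (inv g \<otimes> k) = k"
    using assms by (simp flip: m_assoc)
  then show ?thesis
    using assms by (auto simp: erode_def intro!: bexI[of _ "inv g \<otimes> k"])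
qed

section \<open>Locality of a contraction, by compactness\<close>

lemma compact_space_subshift_space:
  assumes "subshift G A X"
  shows "compact_space (gtop (subshift_space G A X))"
proof -
  have "compact_space (config_topology G A)"
    using assms by (simp add: config_topology_def subshift_def compact_space_product_topology
        compact_space_discrete_topology)
  then have "compactin (config_topology G A) X"
    using assms by (intro closedin_compact_space) (simp_all add: subshift_def)
  then show ?thesis
    by (simp add: subshift_space_def compact_space_subtopology)
qed

lemma openin_interval_space_contains_cylinder:
  assumes "openin (gtop (interval_space G)) U" "const_config G 0 \<in> U"
  obtains M where "finite M" "M \<subseteq> carrier G"
    "\<And>i. i \<in> carrier G \<rightarrow>\<^sub>E {0, 1} \<Longrightarrow> (\<And>m. m \<in> M \<Longrightarrow> i m = 0) \<Longrightarrow> i \<in> U"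
proof -
  have "config_topology G {0, 1::nat} = gtop (interval_space G)"
    using subtopology_topspace[of "config_topology G {0, 1::nat}"]
    by (simp add: interval_space_def subshift_space_def)
  then have "openin (product_topology (\<lambda>_. discrete_topology {0, 1::nat}) (carrier G)) U"
    using assms(1) by (simp add: config_topology_def)
  from product_topology_open_contains_basis[OF this assms(2)]
  obtain V where V: "const_config G 0 \<in> Pi\<^sub>E (carrier G) V" "finite {g. V g \<noteq> {0, 1}}"
    "Pi\<^sub>E (carrier G) V \<subseteq> U"
    by auto
  show ?thesis
  \<comment> \<open>Only the finitely many constrained coordinates matter; off
    \<open>carrier G\<close> the family \<open>V\<close> carries no information.\<close>
  proof (rule that[of "{g. V g \<noteq> {0, 1}} \<inter> carrier G"])
    fix i assume i: "i \<in> carrier G \<rightarrow>\<^sub>E {0, 1::nat}"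
      "\<And>m. m \<in> {g. V g \<noteq> {0, 1}} \<inter> carrier G \<Longrightarrow> i m = 0"
    have "i g \<in> V g" if "g \<in> carrier G" for g
    proof (cases "V g = {0, 1}")
      case True
      then show ?thesis using i(1) that by auto
    next
      case False
      then show ?thesis using i(2) V(1) that by (auto simp: const_config_def)
    qed
    then have "i \<in> Pi\<^sub>E (carrier G) V"
      using i(1) by (simp add: PiE_iff)
    then show "i \<in> U"
      using V(3) by blast
  qed (use V(2) in auto)
qed

text \<open>The tube lemma, applied to the compact slice over the zero configuration, yields a
  window \<open>M\<close> that serves all \<open>x\<close> at the identity. Equivariance carries it
  to every \<open>g\<close>.\<close>

lemma (in group) contraction_local:
  assumes X: "subshift G A X" and z: "z \<in> X" "\<And>g. g \<in> carrier G \<Longrightarrow> shift_act G g z = z"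
    and H: "block_map G (prod_space (interval_space G) (subshift_space G A X)) (subshift_space G A X) H"
    and H0: "\<And>x. x \<in> X \<Longrightarrow> H (const_config G 0, x) = z"
  obtains M where "finite M" "M \<subseteq> carrier G"
    "\<And>i x g. i \<in> carrier G \<rightarrow>\<^sub>E {0, 1} \<Longrightarrow> x \<in> X \<Longrightarrow> g \<in> carrier G \<Longrightarrow>
      (\<And>m. m \<in> M \<Longrightarrow> i (g \<otimes> m) = 0) \<Longrightarrow> H (i, x) g = z g"
proof -
  let ?I = "interval_space G" and ?S = "subshift_space G A X"
  note sub = subshift_subset[OF X]
  note [simp] = topspace_subshift_space[OF sub]
  let ?W = "{t \<in> topspace (gtop (prod_space ?I ?S)). H t \<one> \<in> {z \<one>}}"
  have "continuous_map (gtop (prod_space ?I ?S)) (discrete_topology A) (\<lambda>t. H t \<one>)"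
    using H sub by (simp add: block_map_def continuous_map_subshift_space)
  then have "openin (gtop (prod_space ?I ?S)) ?W"
    by (rule openin_continuous_map_preimage) (use z(1) sub in auto)
  moreover have "compactin (gtop ?S) X"
    using compact_space_subshift_space[OF X] by (simp add: compact_space_def)
  moreover have "{const_config G 0} \<times> X \<subseteq> ?W"
    using H0 by (auto simp: const_config_def)
  ultimately obtain U V where UV: "openin (gtop ?I) U" "const_config G 0 \<in> U" "X \<subseteq> V" "U \<times> V \<subseteq> ?W"
    using tube_lemma_right[of "gtop ?I" "gtop ?S" ?W X "const_config G 0"] by auto
  from openin_interval_space_contains_cylinder[OF UV(1,2)]
  obtain M where M: "finite M" "M \<subseteq> carrier G"
    "\<And>i. i \<in> carrier G \<rightarrow>\<^sub>E {0, 1} \<Longrightarrow> (\<And>m. m \<in> M \<Longrightarrow> i m = 0) \<Longrightarrow> i \<in> U"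
    by blast
  show ?thesis
  proof (rule that[OF M(1,2)])
    fix i x g
    assume i: "i \<in> carrier G \<rightarrow>\<^sub>E {0, 1::nat}" and x: "x \<in> X" and g: "g \<in> carrier G"
      and i0: "\<And>m. m \<in> M \<Longrightarrow> i (g \<otimes> m) = 0"
    \<comment> \<open>This shift moves the coordinate \<open>g\<close> to the identity and
      \<open>g \<otimes> m\<close> to \<open>m\<close>.\<close>
    let ?i = "shift_act G (inv g) i" and ?x = "shift_act G (inv g) x"
    have "?i \<in> carrier G \<rightarrow>\<^sub>E {0, 1}"
      using i g by (auto simp: shift_act_def PiE_iff)
    then have "?i \<in> U"
      by (rule M(3)) (use M(2) g i0 in \<open>auto simp: shift_act_apply\<close>)
    moreover have "?x \<in> X"
      using X x g by (simp add: subshift_def)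
    ultimately have "H (?i, ?x) \<one> = z \<one>"
      using UV(3,4) by blast
    moreover have "H (?i, ?x) \<one> = H (i, x) g"
      using block_map_equivariant[OF H, of "inv g" "(i, x)"] i x g by (simp add: shift_act_apply)
    \<comment> \<open>A fixed point is a constant configuration.\<close>
    moreover have "z \<one> = z g"
      using z(2)[of "inv g"] g shift_act_apply[of \<one> G "inv g" z] by simp
    ultimately show "H (i, x) g = z g" by simp
  qed
qed

section \<open>Gluing two partial contractions\<close>

lemma (in group) contractible_of_contraction:
  assumes X: "subshift_of_finite_type G A X"
    and z: "z \<in> X" "\<And>g. g \<in> carrier G \<Longrightarrow> shift_act G g z = z"
    and H: "block_map G (prod_space (interval_space G) (subshift_space G A X)) (subshift_space G A X) H"
    and H0: "\<And>x. x \<in> X \<Longrightarrow> H (const_config G 0, x) = z"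
    and H1: "\<And>x. x \<in> X \<Longrightarrow> H (const_config G 1, x) = x"
  shows "block_contractible G (subshift_space G A X)"
proof -
  let ?I = "interval_space G" and ?S = "subshift_space G A X"
  let ?T = "prod_space ?I (prod_space ?S ?S)"
  obtain F where F: "finite F" "\<forall>P\<in>F. finite_pattern G A P"
    "X = {x \<in> carrier G \<rightarrow>\<^sub>E A. \<forall>P\<in>F. \<not> appears_in G P x}"
    and shiftX: "subshift G A X"
    using X unfolding subshift_of_finite_type_def by auto
  note sub = subshift_subset[OF shiftX]
  note [simp] = topspace_subshift_space[OF sub]
  obtain M where M: "finite M" "M \<subseteq> carrier G"
    "\<And>i x g. i \<in> carrier G \<rightarrow>\<^sub>E {0, 1} \<Longrightarrow> x \<in> X \<Longrightarrow> g \<in> carrier G \<Longrightarrow>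
      (\<And>m. m \<in> M \<Longrightarrow> i (g \<otimes> m) = 0) \<Longrightarrow> H (i, x) g = z g"
    using contraction_local[OF shiftX z H H0] by blast
  \<comment> \<open>One finite window containing the supports of all forbidden patterns.\<close>
  define W where "W = (\<Union>(D, p)\<in>F. D)"
  have W: "finite W" "W \<subseteq> carrier G"
    using F(1,2) by (auto simp: W_def finite_pattern_def)
  \<comment> \<open>Chosen so that for all \<open>d\<close>, \<open>e\<close> in \<open>W\<close>
    and \<open>m\<close> in \<open>M\<close> the site \<open>g \<otimes> e\<close> lies in the
    translate of \<open>N\<close> by \<open>g \<otimes> d \<otimes> m\<close>.\<close>
  define N where "N = (\<lambda>(m, d, e). inv (d \<otimes> m) \<otimes> e) ` (M \<times> W \<times> W)"
  have N: "finite N" "N \<subseteq> carrier G"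
    using M(1,2) W by (auto simp: N_def subset_iff)
  define K where "K v i x = H (erode G N v i, x)" for v i x
  have erode_I: "erode G N v i \<in> carrier G \<rightarrow>\<^sub>E {0, 1}" for v i
    by (auto simp: erode_def)
  have K_X: "K v i x \<in> X" if "x \<in> X" for v i x
    using block_map_range[OF H, of "(erode G N v i, x)"] that erode_I by (simp add: K_def)
  \<comment> \<open>One site of \<open>gW\<close> where \<open>i\<close> differs from
    \<open>v\<close> makes the erosion vanish on \<open>gdM\<close> for every \<open>d\<close> in
    \<open>W\<close>, so locality of \<open>H\<close> gives \<open>z\<close> on all of
    \<open>gW\<close>.\<close>
  have K_z: "K v i x (g \<otimes> d) = z (g \<otimes> d)"
    if "x \<in> X" "g \<in> carrier G" "d \<in> W" "e \<in> W" "i (g \<otimes> e) \<noteq> v" for v i x g d e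
    unfolding K_def
  proof (rule M(3)[OF erode_I])
    fix m assume m: "m \<in> M"
    have mem: "m \<in> carrier G" "d \<in> carrier G" "e \<in> carrier G"
      using m M(2) that W(2) by auto
    \<comment> \<open>The translation \<open>g\<close> cancels, which is why one finite
      \<open>N\<close> works at every position.\<close>
    have "inv (g \<otimes> d \<otimes> m) \<otimes> (g \<otimes> e) = inv (d \<otimes> m) \<otimes> e"
    proof -
      have "inv g \<otimes> (g \<otimes> e) = e"
        using mem that(2) by (simp flip: m_assoc)
      then show ?thesis
        using mem that(2) by (simp add: inv_mult_group m_assoc)
    qed
    moreover have "inv (d \<otimes> m) \<otimes> e \<in> N"
      unfolding N_def using m that by force
    ultimately show "erode G N v i (g \<otimes> d \<otimes> m) = 0"
      using erode_eq_0[of "g \<otimes> d \<otimes> m" "g \<otimes> e" N i v] mem that N(2) by simp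
  qed (use that W(2) in auto)
  define h where "h t = (\<lambda>g\<in>carrier G. if fst t g = 0 then K 0 (fst t) (fst (snd t)) g
      else K 1 (fst t) (snd (snd t)) g)" for t
  have h_X: "h (i, x, y) \<in> X" if i: "i \<in> carrier G \<rightarrow>\<^sub>E {0, 1}" and x: "x \<in> X" and y: "y \<in> X" for i x y
  proof -
    have "h (i, x, y) \<in> carrier G \<rightarrow>\<^sub>E A"
      using subsetD[OF sub K_X[OF x, of 0 i]] subsetD[OF sub K_X[OF y, of 1 i]]
      by (auto simp: h_def PiE_iff)
    moreover have "\<not> appears_in G (D, p) (h (i, x, y))" if P: "(D, p) \<in> F" for D p
    proof
      assume "appears_in G (D, p) (h (i, x, y))"
      then obtain g where g: "g \<in> carrier G" "\<And>d. d \<in> D \<Longrightarrow> h (i, x, y) (g \<otimes> d) = p d"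
        by (auto simp: appears_in_def)
      have D: "D \<subseteq> W" "D \<subseteq> carrier G"
        using P W(2) by (auto simp: W_def)
      have i01: "i (g \<otimes> d) = 0 \<or> i (g \<otimes> d) = 1" if "d \<in> D" for d
        using i g(1) D that by (auto simp: PiE_iff)
      \<comment> \<open>A point of \<open>X\<close> that agrees with the glued configuration on this
        window would itself contain the forbidden pattern.\<close>
      have "\<exists>w\<in>X. \<forall>d\<in>D. h (i, x, y) (g \<otimes> d) = w (g \<otimes> d)"
      proof -
        consider "\<forall>d\<in>D. i (g \<otimes> d) = 0" | "\<forall>d\<in>D. i (g \<otimes> d) = 1"
          | d e where "d \<in> D" "e \<in> D" "i (g \<otimes> d) \<noteq> 0" "i (g \<otimes> e) \<noteq> 1"
          using i01 by metis
        then show ?thesis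
        proof cases
          case 1
          then show ?thesis
            using D g(1) by (intro bexI[OF _ K_X[OF x, of 0 i]]) (auto simp: h_def)
        next
          case 2
          then show ?thesis
            using D g(1) by (intro bexI[OF _ K_X[OF y, of 1 i]]) (auto simp: h_def)
        next
          case 3
          \<comment> \<open>The site of \<open>d\<close> spoils the erosion for 0 and the site of
            \<open>e\<close> the one for 1, so both branches show \<open>z\<close>.\<close>
          then have "K 0 i x (g \<otimes> c) = z (g \<otimes> c)" "K 1 i y (g \<otimes> c) = z (g \<otimes> c)" if "c \<in> D" for c
            using K_z x y g(1) D(1) that by blast+
          then show ?thesis
            using D g(1) by (intro bexI[OF _ z(1)]) (auto simp: h_def)
        qed
      qed
      then obtain w where "w \<in> X" "\<forall>d\<in>D. w (g \<otimes> d) = p d"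
        using g(2) by metis
      then show False
        using F(3) P g(1) by (force simp: appears_in_def)
    qed
    ultimately show ?thesis
      using F(3) by auto
  qed
  have K_block: "block_map G ?T ?S (\<lambda>t. K v (fst t) (f (snd t)))"
    if "block_map G (prod_space ?S ?S) ?S f" for v f
    using block_map_compose[OF block_map_pair[OF block_map_compose[OF block_map_fst block_map_erode[OF N]]
          block_map_compose[OF block_map_snd that]] H]
    by (simp add: o_def K_def)
  have "block_map G ?T ?S h"
    unfolding h_def
    by (rule block_map_switch[OF sub is_group block_map_fst K_block[OF block_map_fst] K_block[OF block_map_snd]])
      (use h_X in \<open>auto simp: h_def\<close>)
  moreover have "h (const_config G 0, x, y) = x" "h (const_config G 1, x, y) = y"
    if "x \<in> X" "y \<in> X" for x y
  proof -
    have ext: "x \<in> extensional (carrier G)" "y \<in> extensional (carrier G)"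
      using that sub by (auto simp: PiE_def)
    \<comment> \<open>Eroding the constant \<open>v\<close> for the value \<open>v\<close> gives the
      constant 1, where \<open>H\<close> is the identity, for both values of
      \<open>v\<close>.\<close>
    have "K v (const_config G v) x = x" "K v (const_config G v) y = y" for v
      using H1 that N(2) by (simp_all add: K_def erode_const_config)
    then show "h (const_config G 0, x, y) = x" "h (const_config G 1, x, y) = y"
      using ext by (auto simp: h_def const_config_def extensional_def fun_eq_iff)
  qed
  ultimately show ?thesis
    by (auto simp: block_contractible_def block_homotopic_def block_map_fst block_map_snd)
qed

section \<open>One-point subshifts and the equivalence\<close>

lemma (in group) subshift_const_config: "subshift G {b} {const_config G b}"
proof -
  have "{const_config G b} = topspace (config_topology G {b})"
    by (auto simp: const_config_def PiE_iff extensional_def fun_eq_iff)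
  then have "closedin (config_topology G {b}) {const_config G b}"
    by (metis closedin_topspace)
  then show ?thesis
    by (simp add: subshift_def shift_act_const_config)
qed

theorem theorem1p11:
  fixes G :: "('g, 'm) monoid_scheme"
    and A :: "'a set"
    and X :: "('g \<Rightarrow> 'a) set"
  assumes "group G"
    and "subshift_of_finite_type G A X"
  shows "(\<exists>(B :: 'b set) y. subshift G B {y} \<and>
            block_homotopy_equivalent G (subshift_space G A X) (subshift_space G B {y})) \<longleftrightarrow>
         (block_contractible G (subshift_space G A X) \<and>
          (\<exists>x\<in>X. \<forall>g\<in>carrier G. shift_act G g x = x))"
proof -
  interpret group G by fact
  let ?I = "interval_space G" and ?S = "subshift_space G A X"
  have X: "subshift G A X"
    using assms(2) by (simp add: subshift_of_finite_type_def)
  note [simp] = topspace_subshift_space[OF subshift_subset[OF X]]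
  show ?thesis
  proof (intro iffI; elim exE conjE bexE)
    fix B :: "'b set" and y
    assume y: "subshift G B {y}" and equiv: "block_homotopy_equivalent G ?S (subshift_space G B {y})"
    let ?P = "subshift_space G B {y}"
    note [simp] = topspace_subshift_space[OF subshift_subset[OF y]]
    obtain f f' H where f: "block_map G ?S ?P f" and f': "block_map G ?P ?S f'"
      and H: "block_map G (prod_space ?I ?S) ?S H"
      and H01: "\<And>x. x \<in> X \<Longrightarrow> H (const_config G 0, x) = f' (f x) \<and> H (const_config G 1, x) = x"
      using equiv by (auto simp: block_homotopy_equivalent_def block_homotopic_def)
    \<comment> \<open>Hence \<open>f' \<circ> f\<close> is constant on \<open>X\<close> with value
      \<open>f' y\<close>, and \<open>H\<close> contracts \<open>X\<close> to that point, which is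
      fixed because \<open>y\<close> is.\<close>
    have "f x = y" if "x \<in> X" for x
      using block_map_range[OF f, of x] that by simp
    moreover have z: "f' y \<in> X"
      using block_map_range[OF f', of y] by simp
    moreover have fixed: "shift_act G g (f' y) = f' y" if "g \<in> carrier G" for g
      using block_map_equivariant[OF f' that, of y] y that by (simp add: subshift_def)
    ultimately have "block_contractible G ?S"
      using contractible_of_contraction[OF assms(2) z fixed H] H01 by simp
    then show "block_contractible G ?S \<and> (\<exists>x\<in>X. \<forall>g\<in>carrier G. shift_act G g x = x)"
      using z fixed by blast
  next
    fix z
    assume contr: "block_contractible G ?S" and z: "z \<in> X" "\<forall>g\<in>carrier G. shift_act G g z = z"
    obtain h where h: "block_map G (prod_space ?I (prod_space ?S ?S)) ?S h"
      and h01: "\<And>x y. x \<in> X \<Longrightarrow> y \<in> X \<Longrightarrow>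
        h (const_config G 0, x, y) = x \<and> h (const_config G 1, x, y) = y"
      using contr by (auto simp: block_contractible_def block_homotopic_def)
    \<comment> \<open>Types are inhabited, so a one-letter alphabet exists in
      \<open>'b\<close>.\<close>
    fix b :: 'b
    let ?y = "const_config G b"
    let ?P = "subshift_space G {b} {?y}"
    note y = subshift_const_config[of b]
    note [simp] = topspace_subshift_space[OF subshift_subset[OF y]]
    have f: "block_map G S ?P (\<lambda>_. ?y)" for S :: "('g, 'c) gspace"
      by (rule block_map_const) (auto simp: shift_act_const_config)
    have f': "block_map G S ?S (\<lambda>_. z)" for S :: "('g, 'c) gspace"
      by (rule block_map_const) (use z in auto)
    \<comment> \<open>Freezing the first point at \<open>z\<close> turns the homotopy of projections
      into one from the constant \<open>z\<close> to the identity; \<open>z\<close> being fixed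
      keeps it equivariant.\<close>
    have "block_map G (prod_space ?I ?S) ?S (\<lambda>t. h (fst t, z, snd t))"
      using block_map_compose[OF block_map_pair[OF block_map_fst block_map_pair[OF f' block_map_snd]] h]
      by (simp add: o_def)
    then have "block_homotopic G ?S ?S ((\<lambda>_. z) \<circ> (\<lambda>_. ?y)) id"
      unfolding block_homotopic_def using h01 z f' by (auto simp: o_def block_map_id)
    \<comment> \<open>On a one-point space the constant map serves as the homotopy.\<close>
    moreover have "block_homotopic G ?P ?P ((\<lambda>_. ?y) \<circ> (\<lambda>_. z)) id"
      unfolding block_homotopic_def o_def using f[of ?P] f[of "prod_space ?I ?P"] 
      by (auto simp: block_map_id)
    ultimately have "block_homotopy_equivalent G ?S ?P"
      unfolding block_homotopy_equivalent_def using f f' by blast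
    then show "\<exists>(B :: 'b set) y. subshift G B {y} \<and>
        block_homotopy_equivalent G ?S (subshift_space G B {y})"
      using y by blast
  qed
qed

end
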